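(* Let $\mathbf V$ be a congruence-modular variety of algebras and let $A\in\mathbf V$. Then the lattice $\operatorname{SupEqv} A$ of compatible superequivalences on $A$, ordered by inclusion, is modular.
   Context: For a set $S$, $\operatorname{Rel} S$ is the complete lattice of all binary relations on $S$, ordered by inclusion. An ideal of a lattice is a nonempty subset that is closed downward and closed under binary joins; $\operatorname{Idl}\operatorname{Rel} S$ is the set of ideals of $\operatorname{Rel} S$, ordered by inclusion (so an ideal of relations is a nonempty set of relations closed under subrelations and finite unions). For a nonempty set $X$ of relations, $\operatorname{Ig} X$ is the ideal generated by $X$. Composition: $a\,(R\circ R')\,c$ iff there is $b$ with $a\,R\,b$ and $b\,R'\,c$; $R^{\mathrm{op}}$ is the opposite relation. For ideals, $\mathcal I^{\mathrm{op}}=\{R^{\mathrm{op}}\mid R\in\mathcal I\}$ and $\mathcal I\circ\mathcal I'=\operatorname{Ig}\{R\circ R'\mid R\in\mathcal I,\ R'\in\mathcal I'\}$. A superequivalence on $S$ is an $\mathcal I\in\operatorname{Idl}\operatorname{Rel} S$ such that $\Delta_S\in\mathcal I$ (where $\Delta_S$ is the identity relation), $\mathcal I=\mathcal I^{\mathrm{op}}$, and $\mathcal I\circ\mathcal I\subseteq\mathcal I$. Let $A$ be an algebra (its underlying set may be empty). A superequivalence $\mathcal I$ on the underlying set of $A$ is compatible if for every $n$ and every $n$-ary basic operation $\omega$ of $A$, and all $R_1,\ldots,R_n\in\mathcal I$, the relation $\omega(R_1,\ldots,R_n)=\{\langle\omega(a_1,\ldots,a_n),\omega(b_1,\ldots,b_n)\rangle\mid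 \langle a_i,b_i\rangle\in R_i\text{ for all }i\}$ belongs to $\mathcal I$. $\operatorname{SupEqv} A$ denotes the set of compatible superequivalences on $A$, ordered by inclusion; it is a (complete) lattice. A variety is congruence-modular if every algebra in it has a modular congruence lattice. *)

theory Defs
  imports "HOL-Algebra.Lattice" "HOL-Library.Equipollence"
begin

section \<open>Modular lattices, inclusion orders\<close>

locale modular_lattice = lattice +
  assumes modular:
    "\<lbrakk>x \<in> carrier L; y \<in> carrier L; z \<in> carrier L; x \<sqsubseteq> z\<rbrakk>
      \<Longrightarrow> x \<squnion> (y \<sqinter> z) = (x \<squnion> y) \<sqinter> z"

definition by_inclusion :: "'a set set \<Rightarrow> 'a set gorder" where
  "by_inclusion C = \<lparr>carrier = C, eq = (=), le = (\<subseteq>)\<rparr>"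


section \<open>Ideals of relations, superequivalences\<close>

definition Idl_Rel :: "'a set \<Rightarrow> 'a rel set set" where
  "Idl_Rel S = {I. I \<noteq> {} \<and> I \<subseteq> Pow (S \<times> S) \<and>
     (\<forall>R\<in>I. \<forall>Q. Q \<subseteq> R \<longrightarrow> Q \<in> I) \<and> (\<forall>R\<in>I. \<forall>Q\<in>I. R \<union> Q \<in> I)}"

definition Ig :: "'a set \<Rightarrow> 'a rel set \<Rightarrow> 'a rel set" where
  "Ig S X = \<Inter>{I \<in> Idl_Rel S. X \<subseteq> I}"

definition ideal_op :: "'a rel set \<Rightarrow> 'a rel set" where
  "ideal_op I = {R\<inverse> |R. R \<in> I}"

definition ideal_comp :: "'a set \<Rightarrow> 'a rel set \<Rightarrow> 'a rel set \<Rightarrow> 'a rel set" where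
  "ideal_comp S I J = Ig S {R O Q |R Q. R \<in> I \<and> Q \<in> J}"

definition superequivalence :: "'a set \<Rightarrow> 'a rel set \<Rightarrow> bool" where
  "superequivalence S I \<longleftrightarrow>
     I \<in> Idl_Rel S \<and> Id_on S \<in> I \<and> I = ideal_op I \<and> ideal_comp S I I \<subseteq> I"


section \<open>Algebras and varieties\<close>

text \<open>
  The operation symbols form a set, not the whole type \<open>'f\<close>, so that signatures without
  operations are allowed. The carrier of an algebra may be empty.
  An \<open>n\<close>-ary operation is a function on lists, relevant only on lists of length \<open>n\<close> over
  the carrier.
\<close>

record 'f signature =
  symbs :: "'f set"
  arity :: "'f \<Rightarrow> nat"

record ('f, 'a) ualgebra = "'a partial_object" +
  oper :: "'f \<Rightarrow> 'a list \<Rightarrow> 'a"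

definition is_algebra :: "'f signature \<Rightarrow> ('f, 'a) ualgebra \<Rightarrow> bool" where
  "is_algebra \<Sigma> A \<longleftrightarrow>
     (\<forall>f\<in>symbs \<Sigma>. \<forall>as. length as = arity \<Sigma> f \<and> set as \<subseteq> carrier A
        \<longrightarrow> oper A f as \<in> carrier A)"

datatype 'f trm = Var nat | App 'f "'f trm list"

inductive_set terms :: "'f signature \<Rightarrow> 'f trm set" for \<Sigma> :: "'f signature" where
  Var: "Var i \<in> terms \<Sigma>"
| App: "\<lbrakk>f \<in> symbs \<Sigma>; length ts = arity \<Sigma> f; \<forall>t\<in>set ts. t \<in> terms \<Sigma>\<rbrakk>
        \<Longrightarrow> App f ts \<in> terms \<Sigma>"

primrec eval :: "('f, 'a) ualgebra \<Rightarrow> (nat \<Rightarrow> 'a) \<Rightarrow> 'f trm \<Rightarrow> 'a" where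
  "eval A v (Var i) = v i"
| "eval A v (App f ts) = oper A f (map (eval A v) ts)"

definition satisfies :: "('f, 'a) ualgebra \<Rightarrow> 'f trm \<times> 'f trm \<Rightarrow> bool" where
  "satisfies A e \<longleftrightarrow>
     (\<forall>v. range v \<subseteq> carrier A \<longrightarrow> eval A v (fst e) = eval A v (snd e))"

text \<open>
  A variety is the class of all algebras satisfying a set \<open>E\<close> of identities. As a class
  ranging over all types is not a HOL object, it is represented by \<open>\<Sigma>\<close> and \<open>E\<close>; the constant
  below is polymorphic in the type \<open>'a\<close> of elements.
\<close>

definition variety :: "'f signature \<Rightarrow> ('f trm \<times> 'f trm) set \<Rightarrow> ('f, 'a) ualgebra set" where
  "variety \<Sigma> E = {A. is_algebra \<Sigma> A \<and> (\<forall>e\<in>E. satisfies A e)}"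


section \<open>Congruences and compatible superequivalences\<close>

definition Con :: "'f signature \<Rightarrow> ('f, 'a) ualgebra \<Rightarrow> 'a rel set" where
  "Con \<Sigma> A = {\<theta>. equiv (carrier A) \<theta> \<and>
     (\<forall>f\<in>symbs \<Sigma>. \<forall>as bs. length as = arity \<Sigma> f \<and> list_all2 (\<lambda>a b. (a, b) \<in> \<theta>) as bs
        \<longrightarrow> (oper A f as, oper A f bs) \<in> \<theta>)}"

text \<open>
  The quantifier over algebras is restricted to those with elements in \<open>'u\<close>. This is the
  unrestricted notion as soon as \<open>'u\<close> has room for all terms: three congruences that violate
  the modular law do so already on a subalgebra no larger than the set of terms.
\<close>

definition congruence_modular ::
    "'u itself \<Rightarrow> 'f signature \<Rightarrow> ('f trm \<times> 'f trm) set \<Rightarrow> bool" where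
  "congruence_modular (_ :: 'u itself) \<Sigma> E \<longleftrightarrow>
     (\<forall>B :: ('f, 'u) ualgebra. B \<in> variety \<Sigma> E \<longrightarrow> modular_lattice (by_inclusion (Con \<Sigma> B)))"

definition rel_oper :: "('f, 'a) ualgebra \<Rightarrow> 'f \<Rightarrow> 'a rel list \<Rightarrow> 'a rel" where
  "rel_oper A f Rs = {(oper A f as, oper A f bs) |as bs.
     length as = length Rs \<and> length bs = length Rs \<and>
     (\<forall>i<length Rs. (as ! i, bs ! i) \<in> Rs ! i)}"

definition compatible :: "'f signature \<Rightarrow> ('f, 'a) ualgebra \<Rightarrow> 'a rel set \<Rightarrow> bool" where
  "compatible \<Sigma> A I \<longleftrightarrow>
     (\<forall>f\<in>symbs \<Sigma>. \<forall>Rs. length Rs = arity \<Sigma> f \<and> set Rs \<subseteq> I \<longrightarrow> rel_oper A f Rs \<in> I)"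

definition SupEqv :: "'f signature \<Rightarrow> ('f, 'a) ualgebra \<Rightarrow> 'a rel set set" where
  "SupEqv \<Sigma> A = {I. superequivalence (carrier A) I \<and> compatible \<Sigma> A I}"

end

theory Submission
  imports Defs
begin

text \<open>
  The proof carries Day's argument for congruences over to ideals of relations. Write
  \<open>t[a, b, d, c]\<close> for the value of a term \<open>t\<close> at these four elements. Modularity of the
  congruence lattice of the algebra of all term functions of \<open>A\<close>, applied to three explicit
  congruences of that algebra, gives a finite chain of terms from the first variable to the
  fourth one. All its members satisfy \<open>t[a, b, b, a] = a\<close>, and neighbours \<open>s\<close>, \<open>t\<close> satisfy
  either \<open>s[a, b, b, c] = t[a, b, b, c]\<close> for all \<open>a\<close>, \<open>b\<close>, \<open>c\<close> or
  \<open>s[a, a, c, c] = t[a, a, c, c]\<close> for all \<open>a\<close>, \<open>c\<close> (lemma \<open>day_chain\<close>).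

  Meets of compatible superequivalences are intersections. The join of \<open>I\<close> and \<open>J\<close> is the union
  of the stages \<open>\<Phi>\<^sub>0 = J\<close> and \<open>\<Phi>\<^sub>k\<^sub>+\<^sub>1 = \<close> all subrelations of some \<open>P O R O Q\<close> with \<open>P, Q \<in> \<Phi>\<^sub>k\<close> and
  \<open>R \<in> I\<close>. A stage need not be closed under composition, but it is a compatible ideal that
  contains the identity and is closed under converses. For the modular law with \<open>I \<subseteq> K\<close> it
  remains to show \<open>\<Phi>\<^sub>k \<inter> K \<subseteq> W\<close> for every \<open>k\<close>, where \<open>W\<close> is the join of \<open>I\<close> and \<open>J \<inter> K\<close>. For
  \<open>k = 0\<close> this is the choice of \<open>W\<close>; the induction step is the shifting lemma \<open>sandwich_shift\<close>.

  For the step, let \<open>T \<in> K\<close> with \<open>T \<subseteq> P O R O Q\<close>, and consider all \<open>(a, c) \<in> T\<close> with all their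
  witnesses \<open>a P b R d Q c\<close>. For a term \<open>t\<close> of the chain, the relation of all pairs
  \<open>(t[a, a, c, c], t[a, b, d, c])\<close> is in \<open>\<Phi>\<^sub>k\<close>, because the pairs of arguments are related by
  \<open>P\<close>, \<open>Q\<inverse>\<close> or the identity; and it is in \<open>K\<close>, because both sides are \<open>K\<close>-related to
  \<open>a = t[a, b, b, a]\<close>. By induction it is in \<open>W\<close>. So, walking along the chain, one passes from
  \<open>s[a, b, d, c]\<close> to \<open>t[a, b, d, c]\<close> by relations in \<open>W\<close>: through \<open>s[a, b, b, c]\<close>, using
  \<open>R \<in> I \<subseteq> W\<close>, or through \<open>s[a, a, c, c]\<close>, using the relations just described. The chain leads
  from \<open>a\<close> to \<open>c\<close>, hence \<open>T \<in> W\<close>. As every relation is treated as a whole, only finitely many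
  members of \<open>W\<close> are composed, however many pairs \<open>T\<close> has.
\<close>

section \<open>Modularity of lattices ordered by inclusion\<close>

lemma by_inclusion_simps [simp]:
  "carrier (by_inclusion C) = C"
  "X .=\<^bsub>by_inclusion C\<^esub> Y \<longleftrightarrow> X = Y"
  "X \<sqsubseteq>\<^bsub>by_inclusion C\<^esub> Y \<longleftrightarrow> X \<subseteq> Y"
  by (simp_all add: by_inclusion_def)

lemma partial_order_by_inclusion: "partial_order (by_inclusion C)"
  by unfold_locales (auto simp: by_inclusion_def)

lemma least_by_inclusion:
  assumes "X \<in> C" "Y \<in> C"
  shows "least (by_inclusion C) U (Upper (by_inclusion C) {X, Y}) \<longleftrightarrow>
     U \<in> C \<and> X \<union> Y \<subseteq> U \<and> (\<forall>Z\<in>C. X \<union> Y \<subseteq> Z \<longrightarrow> U \<subseteq> Z)"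
proof -
  have "Upper (by_inclusion C) {X, Y} = {Z \<in> C. X \<union> Y \<subseteq> Z}"
    using assms unfolding Upper_def by fastforce
  then show ?thesis unfolding least_def by auto
qed

lemma greatest_by_inclusion:
  assumes "X \<in> C" "Y \<in> C"
  shows "greatest (by_inclusion C) U (Lower (by_inclusion C) {X, Y}) \<longleftrightarrow>
     U \<in> C \<and> U \<subseteq> X \<inter> Y \<and> (\<forall>Z\<in>C. Z \<subseteq> X \<inter> Y \<longrightarrow> Z \<subseteq> U)"
proof -
  have "Lower (by_inclusion C) {X, Y} = {Z \<in> C. Z \<subseteq> X \<inter> Y}"
    using assms unfolding Lower_def by fastforce
  then show ?thesis unfolding greatest_def by auto
qed

lemma modular_lattice_by_inclusionI:
  assumes int: "\<And>X Y. X \<in> C \<Longrightarrow> Y \<in> C \<Longrightarrow> X \<inter> Y \<in> C"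
    and join: "\<And>X Y. X \<in> C \<Longrightarrow> Y \<in> C \<Longrightarrow> j X Y \<in> C"
    and upper: "\<And>X Y. X \<in> C \<Longrightarrow> Y \<in> C \<Longrightarrow> X \<union> Y \<subseteq> j X Y"
    and least: "\<And>X Y Z. X \<in> C \<Longrightarrow> Y \<in> C \<Longrightarrow> Z \<in> C \<Longrightarrow> X \<union> Y \<subseteq> Z \<Longrightarrow> j X Y \<subseteq> Z"
    and mod: "\<And>X Y Z. X \<in> C \<Longrightarrow> Y \<in> C \<Longrightarrow> Z \<in> C \<Longrightarrow> X \<subseteq> Z \<Longrightarrow> j X Y \<inter> Z \<subseteq> j X (Y \<inter> Z)"
  shows "modular_lattice (by_inclusion C)"
proof -
  interpret L: partial_order "by_inclusion C" by (rule partial_order_by_inclusion)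
  have lub: "least (by_inclusion C) (j X Y) (Upper (by_inclusion C) {X, Y})"
    if "X \<in> C" "Y \<in> C" for X Y
    using join upper least that by (simp add: least_by_inclusion)
  have glb: "greatest (by_inclusion C) (X \<inter> Y) (Lower (by_inclusion C) {X, Y})"
    if "X \<in> C" "Y \<in> C" for X Y
    using int that by (simp add: greatest_by_inclusion)
  interpret L: lattice "by_inclusion C"
    by unfold_locales (metis by_inclusion_simps(1) lub, metis by_inclusion_simps(1) glb)
  have join_eq: "X \<squnion>\<^bsub>by_inclusion C\<^esub> Y = j X Y" if "X \<in> C" "Y \<in> C" for X Y
    unfolding join_def
    using L.least_unique[OF L.sup_of_two_least lub] that by simp
  have meet_eq: "X \<sqinter>\<^bsub>by_inclusion C\<^esub> Y = X \<inter> Y" if "X \<in> C" "Y \<in> C" for X Y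
    unfolding meet_def
    using L.greatest_unique[OF L.inf_of_two_greatest glb] that by simp
  have "j X (Y \<inter> Z) = j X Y \<inter> Z" if "X \<in> C" "Y \<in> C" "Z \<in> C" "X \<subseteq> Z" for X Y Z
  proof
    show "j X (Y \<inter> Z) \<subseteq> j X Y \<inter> Z"
      using that int join upper by (intro least) blast+
  qed (use mod that in blast)
  then show ?thesis
    by unfold_locales (simp add: join_eq meet_eq int join)
qed

text \<open>
  A form of the modular law that avoids computing joins: any upper bound \<open>V\<close> of \<open>X\<close> and
  \<open>Y \<inter> Z\<close> lies above their join.
\<close>

lemma modular_lattice_by_inclusionD:
  assumes "modular_lattice (by_inclusion C)"
    and XYZ: "X \<in> C" "Y \<in> C" "Z \<in> C" "X \<subseteq> Z"
    and int: "\<And>X Y. X \<in> C \<Longrightarrow> Y \<in> C \<Longrightarrow> X \<inter> Y \<in> C"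
    and V: "V \<in> C" "X \<subseteq> V" "Y \<inter> Z \<subseteq> V"
  obtains J where "J \<in> C" "X \<subseteq> J" "Y \<subseteq> J" "J \<inter> Z \<subseteq> V"
proof -
  interpret L: modular_lattice "by_inclusion C" by fact
  have meet_eq: "X \<sqinter>\<^bsub>by_inclusion C\<^esub> Y = X \<inter> Y" if "X \<in> C" "Y \<in> C" for X Y
  proof -
    have "greatest (by_inclusion C) (X \<inter> Y) (Lower (by_inclusion C) {X, Y})"
      using int that by (simp add: greatest_by_inclusion)
    from L.greatest_unique[OF L.inf_of_two_greatest this] that show ?thesis
      by (simp add: meet_def)
  qed
  let ?J = "X \<squnion>\<^bsub>by_inclusion C\<^esub> Y"
  have J: "?J \<in> C" "X \<subseteq> ?J" "Y \<subseteq> ?J"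
    using XYZ L.join_closed[of X Y] L.join_left[of X Y] L.join_right[of X Y] by auto
  have "X \<squnion>\<^bsub>by_inclusion C\<^esub> (Y \<inter> Z) = ?J \<inter> Z"
    using L.modular[of X Y Z] XYZ J by (simp add: meet_eq)
  moreover have "X \<squnion>\<^bsub>by_inclusion C\<^esub> (Y \<inter> Z) \<subseteq> V"
    using L.join_le[of X V "Y \<inter> Z"] XYZ V int by simp
  ultimately show ?thesis using that J by simp
qed


section \<open>Day's condition for congruence modularity\<close>

lemma terms_eval_closed:
  assumes "is_algebra \<Sigma> A" "t \<in> terms \<Sigma>" "range v \<subseteq> carrier A"
  shows "eval A v t \<in> carrier A"
  using assms(2)
proof induction
  case (App f ts)
  then have "set (map (eval A v) ts) \<subseteq> carrier A" by auto
  with App assms(1) show ?case unfolding is_algebra_def by simp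
qed (use assms(3) in auto)

text \<open>
  The algebra of all term functions of \<open>A\<close> in countably many variables, that is, the free algebra
  of the variety generated by \<open>A\<close>, with elements coded in \<open>'u\<close>: each term function is
  represented by one chosen term defining it. The map \<open>h v\<close> evaluates a term function at the
  valuation \<open>v\<close>. These maps are homomorphisms to \<open>A\<close> and jointly injective, which gives the
  identities. If \<open>A\<close> is empty, there are no valuations and the algebra has just one element.
\<close>

lemma term_function_algebra:
  fixes A :: "('f, 'a) ualgebra" and E :: "('f trm \<times> 'f trm) set"
  assumes A: "A \<in> variety \<Sigma> E" and E: "E \<subseteq> terms \<Sigma> \<times> terms \<Sigma>"
    and room: "terms \<Sigma> \<lesssim> (UNIV :: 'u set)"
  obtains F :: "('f, 'u) ualgebra" and h :: "(nat \<Rightarrow> 'a) \<Rightarrow> 'u \<Rightarrow> 'a"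
  where "F \<in> variety \<Sigma> E"
    and "\<And>v f ps. range v \<subseteq> carrier A \<Longrightarrow> f \<in> symbs \<Sigma> \<Longrightarrow> length ps = arity \<Sigma> f
      \<Longrightarrow> set ps \<subseteq> carrier F \<Longrightarrow> h v (oper F f ps) = oper A f (map (h v) ps)"
    and "\<And>p. p \<in> carrier F
      \<Longrightarrow> \<exists>t\<in>terms \<Sigma>. \<forall>v. range v \<subseteq> carrier A \<longrightarrow> h v p = eval A v t"
    and "\<And>t. t \<in> terms \<Sigma>
      \<Longrightarrow> \<exists>p\<in>carrier F. \<forall>v. range v \<subseteq> carrier A \<longrightarrow> h v p = eval A v t"
proof -
  obtain \<iota> :: "'f trm \<Rightarrow> 'u" where \<iota>: "inj_on \<iota> (terms \<Sigma>)"
    using room unfolding lepoll_def by auto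
  define nf where "nf t = (SOME s. s \<in> terms \<Sigma> \<and> satisfies A (s, t))" for t
  have nf: "nf t \<in> terms \<Sigma>" "satisfies A (nf t, t)" if "t \<in> terms \<Sigma>" for t
  proof -
    have "t \<in> terms \<Sigma> \<and> satisfies A (t, t)" using that by (simp add: satisfies_def)
    then have "nf t \<in> terms \<Sigma> \<and> satisfies A (nf t, t)" unfolding nf_def by (rule someI)
    then show "nf t \<in> terms \<Sigma>" "satisfies A (nf t, t)" by auto
  qed
  have nf_cong: "nf s = nf t" if "satisfies A (s, t)" for s t
  proof -
    have "satisfies A (r, s) \<longleftrightarrow> satisfies A (r, t)" for r
      using that unfolding satisfies_def by auto
    then show ?thesis unfolding nf_def by simp
  qed
  define un where "un = inv_into (terms \<Sigma>) \<iota>"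
  have un_\<iota> [simp]: "un (\<iota> t) = t" if "t \<in> terms \<Sigma>" for t
    unfolding un_def using \<iota> that by simp
  define F :: "('f, 'u) ualgebra" where
    "F = \<lparr>carrier = \<iota> ` nf ` terms \<Sigma>, oper = \<lambda>f ps. \<iota> (nf (App f (map un ps)))\<rparr>"
  define h where "h v p = eval A v (un p)" for v p
  have un: "un p \<in> terms \<Sigma>" "\<iota> (nf (un p)) = p" if "p \<in> carrier F" for p
  proof -
    from that obtain t where t: "t \<in> terms \<Sigma>" "p = \<iota> (nf t)" unfolding F_def by auto
    then have *: "un p = nf t" using nf(1) by simp
    then show "un p \<in> terms \<Sigma>" using nf(1) t by simp
    show "\<iota> (nf (un p)) = p" using * nf_cong[OF nf(2)[OF t(1)]] t by simp
  qed
  have App: "App f (map un ps) \<in> terms \<Sigma>"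
    if "f \<in> symbs \<Sigma>" "length ps = arity \<Sigma> f" "set ps \<subseteq> carrier F" for f ps
    using that un by (intro terms.App) auto
  have alg: "is_algebra \<Sigma> F"
    using App unfolding is_algebra_def by (auto simp: F_def)
  have hom: "h v (oper F f ps) = oper A f (map (h v) ps)"
    if "range v \<subseteq> carrier A" "f \<in> symbs \<Sigma>" "length ps = arity \<Sigma> f" "set ps \<subseteq> carrier F"
    for v f ps
  proof -
    have "eval A v (nf (App f (map un ps))) = eval A v (App f (map un ps))"
      using nf(2)[OF App[OF that(2-)]] that(1) by (simp add: satisfies_def)
    then show ?thesis
      using nf(1)[OF App[OF that(2-)]] by (simp add: h_def[abs_def] F_def comp_def)
  qed
  have separates: "p = q"
    if "p \<in> carrier F" "q \<in> carrier F" "\<And>v. range v \<subseteq> carrier A \<Longrightarrow> h v p = h v q" for p q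
  proof -
    have "satisfies A (un p, un q)" using that(3) by (simp add: satisfies_def h_def)
    from nf_cong[OF this] un(2)[OF that(1)] un(2)[OF that(2)] show ?thesis by metis
  qed
  have h_eval: "h v (eval F w t) = eval A (h v \<circ> w) t"
    if v: "range v \<subseteq> carrier A" and w: "range w \<subseteq> carrier F" and t: "t \<in> terms \<Sigma>" for v w t
    using t
  proof induction
    case (App f ts)
    have "set (map (eval F w) ts) \<subseteq> carrier F"
      using App terms_eval_closed[OF alg _ w] by auto
    then have "h v (eval F w (App f ts)) = oper A f (map (h v) (map (eval F w) ts))"
      using App hom[OF v] by simp
    also have "map (h v) (map (eval F w) ts) = map (eval A (h v \<circ> w)) ts"
      using App by (simp add: comp_def)
    finally show ?case by (simp add: comp_def)
  qed simp
  have h_closed: "h v p \<in> carrier A" if "range v \<subseteq> carrier A" "p \<in> carrier F" for v p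
    using terms_eval_closed[OF _ un(1)[OF that(2)] that(1)] A by (simp add: h_def variety_def)
  have "satisfies F (s, t)" if st: "(s, t) \<in> E" for s t
  proof -
    have terms: "s \<in> terms \<Sigma>" "t \<in> terms \<Sigma>" using E st by auto
    have "eval F w s = eval F w t" if w: "range w \<subseteq> carrier F" for w
    proof (rule separates)
      fix v :: "nat \<Rightarrow> 'a" assume v: "range v \<subseteq> carrier A"
      have "range (h v \<circ> w) \<subseteq> carrier A" using h_closed[OF v] w by auto
      then show "h v (eval F w s) = h v (eval F w t)"
        using A st h_eval[OF v w] terms by (auto simp: variety_def satisfies_def)
    qed (use terms_eval_closed[OF alg _ w] terms in auto)
    then show ?thesis by (simp add: satisfies_def)
  qed
  then have "F \<in> variety \<Sigma> E" using alg by (auto simp: variety_def)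
  moreover have "\<exists>p\<in>carrier F. \<forall>v. range v \<subseteq> carrier A \<longrightarrow> h v p = eval A v t"
    if "t \<in> terms \<Sigma>" for t
  proof
    show "\<iota> (nf t) \<in> carrier F" using that by (simp add: F_def)
    show "\<forall>v. range v \<subseteq> carrier A \<longrightarrow> h v (\<iota> (nf t)) = eval A v t"
      using nf[OF that] by (auto simp: h_def satisfies_def)
  qed
  moreover have "\<exists>t\<in>terms \<Sigma>. \<forall>v. range v \<subseteq> carrier A \<longrightarrow> h v p = eval A v t"
    if "p \<in> carrier F" for p
    using un(1)[OF that] by (auto simp: h_def)
  ultimately show thesis using that hom by blast
qed

text \<open>
  Arguments can be changed one at a time, and for each of them a path of \<open>r\<close>-steps can be
  followed while the others stay fixed.
\<close>

lemma rtrancl_compatible: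
  assumes r: "r \<subseteq> S \<times> S"
    and step: "\<And>us a b ys. set us \<subseteq> S \<Longrightarrow> set ys \<subseteq> S \<Longrightarrow> (a, b) \<in> r
      \<Longrightarrow> length us + length ys + 1 = n \<Longrightarrow> (f (us @ a # ys), f (us @ b # ys)) \<in> r\<^sup>*"
    and all: "list_all2 (\<lambda>a b. (a, b) \<in> r\<^sup>*) as bs" "set as \<subseteq> S" "length as = n"
  shows "(f as, f bs) \<in> r\<^sup>*"
proof -
  have closed: "b \<in> S" if "(a, b) \<in> r\<^sup>*" "a \<in> S" for a b
    using that r by (induction) auto
  have one: "(f (us @ a # ys), f (us @ b # ys)) \<in> r\<^sup>*"
    if "(a, b) \<in> r\<^sup>*" "set us \<subseteq> S" "set ys \<subseteq> S" "length us + length ys + 1 = n" for us a b ys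
    using that(1)
  proof induction
    case (step b c)
    with assms(2)[OF that(2,3) step(2) that(4)] show ?case by (meson rtrancl_trans)
  qed simp
  have "(f (us @ as), f (us @ bs)) \<in> r\<^sup>*"
    if "set us \<subseteq> S" "set as \<subseteq> S" "length us + length as = n" for us
    using all(1) that
  proof (induction arbitrary: us rule: list_all2_induct)
    case (Cons a as b bs)
    have "(f (us @ a # as), f (us @ b # as)) \<in> r\<^sup>*"
      using Cons by (intro one) auto
    moreover have "(f ((us @ [b]) @ as), f ((us @ [b]) @ bs)) \<in> r\<^sup>*"
      using Cons closed[of a b] by (intro Cons.IH) auto
    ultimately show ?case by simp
  qed simp
  from this[of "[]"] all show ?thesis by simp
qed

lemma Con_rtrancl_Un:
  assumes alg: "is_algebra \<Sigma> F" and \<theta>: "\<theta> \<in> Con \<Sigma> F" and \<phi>: "\<phi> \<in> Con \<Sigma> F"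
  shows "(\<theta> \<union> \<phi>)\<^sup>* \<inter> carrier F \<times> carrier F \<in> Con \<Sigma> F"
proof -
  let ?r = "\<theta> \<union> \<phi>" and ?S = "carrier F"
  have eq: "equiv ?S \<theta>" "equiv ?S \<phi>" using \<theta> \<phi> by (auto simp: Con_def)
  have r: "?r \<subseteq> ?S \<times> ?S"
    using eq by (auto simp: equiv_def refl_on_def)
  have sub: "(oper F f (us @ a # ys), oper F f (us @ b # ys)) \<in> \<rho>"
    if \<rho>: "\<rho> \<in> Con \<Sigma> F" and f: "f \<in> symbs \<Sigma>" and us: "set us \<subseteq> ?S" and ys: "set ys \<subseteq> ?S"
      and ab: "(a, b) \<in> \<rho>" and l: "length us + length ys + 1 = arity \<Sigma> f" for \<rho> us ys a b f
  proof -
    have refl: "(x, x) \<in> \<rho>" if "x \<in> ?S" for x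
      using \<rho> that by (auto simp: Con_def equiv_def refl_on_def)
    have "list_all2 (\<lambda>a b. (a, b) \<in> \<rho>) us us" "list_all2 (\<lambda>a b. (a, b) \<in> \<rho>) ys ys"
      using refl us ys by (auto intro!: list.rel_refl_strong)
    then have "list_all2 (\<lambda>a b. (a, b) \<in> \<rho>) (us @ a # ys) (us @ b # ys)"
      using ab by (simp add: list_all2_appendI)
    then show ?thesis using \<rho> f l by (auto simp: Con_def)
  qed
  have "sym ?r" using eq by (auto simp: equiv_def sym_def)
  then have "sym (?r\<^sup>*)" by (rule sym_rtrancl)
  then have "equiv ?S (?r\<^sup>* \<inter> ?S \<times> ?S)"
    by (auto simp: equiv_def refl_on_def sym_def trans_def)
  moreover have "(oper F f as, oper F f bs) \<in> ?r\<^sup>* \<inter> ?S \<times> ?S"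
    if f: "f \<in> symbs \<Sigma>" and l: "length as = arity \<Sigma> f"
      and all: "list_all2 (\<lambda>a b. (a, b) \<in> ?r\<^sup>* \<inter> ?S \<times> ?S) as bs" for f as bs
  proof -
    have len: "length bs = length as" using all list_all2_lengthD by force
    have S: "set as \<subseteq> ?S" "set bs \<subseteq> ?S"
      using all by (auto simp: list_all2_conv_all_nth in_set_conv_nth)
    have star: "list_all2 (\<lambda>a b. (a, b) \<in> ?r\<^sup>*) as bs"
      using all by (rule list_all2_mono) auto
    have step: "(oper F f (us @ a # ys), oper F f (us @ b # ys)) \<in> ?r\<^sup>*"
      if "set us \<subseteq> ?S" "set ys \<subseteq> ?S" "(a, b) \<in> ?r" "length us + length ys + 1 = arity \<Sigma> f"
      for us a b ys
      using sub[OF \<theta> f that(1,2) _ that(4)] sub[OF \<phi> f that(1,2) _ that(4)] that(3) by blast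
    have "(oper F f as, oper F f bs) \<in> ?r\<^sup>*"
      by (rule rtrancl_compatible[OF r, where n = "arity \<Sigma> f" and f = "oper F f",
            OF step star S(1) l])
    then show ?thesis using alg f l len S by (auto simp: is_algebra_def)
  qed
  ultimately show ?thesis by (auto simp: Con_def)
qed

text \<open>
  The valuation that gives the variables \<open>0\<close>, \<open>1\<close>, \<open>2\<close>, \<open>3\<close> the listed values. The last value
  is also used for all further variables, so that terms in any variables act as quaternary ones.
\<close>

definition quad :: "'b \<Rightarrow> 'b \<Rightarrow> 'b \<Rightarrow> 'b \<Rightarrow> nat \<Rightarrow> 'b" where
  "quad a b c d n = (if n = 0 then a else if n = 1 then b else if n = 2 then c else d)"

definition agree :: "('f, 'a) ualgebra \<Rightarrow> (nat \<Rightarrow> 'a) set \<Rightarrow> 'f trm \<Rightarrow> 'f trm \<Rightarrow> bool" where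
  "agree A V s t \<longleftrightarrow> (\<forall>v\<in>V. eval A v s = eval A v t)"

text \<open>
  With \<open>\<theta>\<close>, \<open>\<chi>\<close>, \<open>\<psi>\<close> for agreement on the three sets of valuations, a step is a pair in
  \<open>\<theta> \<union> (\<chi> \<inter> \<psi>)\<close>. On the algebra of term functions in \<open>x\<close>, \<open>y\<close>, \<open>z\<close>, \<open>u\<close> these are the
  congruences generated by \<open>(y, z)\<close>, by \<open>(x, u), (y, z)\<close>, and by \<open>(x, y), (z, u)\<close>. The steps replace the
  alternating equations of Day's terms; here the two kinds of steps come in any order.
\<close>

definition day_step :: "'f signature \<Rightarrow> ('f, 'a) ualgebra \<Rightarrow> 'f trm rel" where
  "day_step \<Sigma> A = {(s, t) \<in> terms \<Sigma> \<times> terms \<Sigma>. let S = carrier A in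
     agree A {quad a b b c |a b c. a \<in> S \<and> b \<in> S \<and> c \<in> S} s t \<or>
     agree A {quad a b b a |a b. a \<in> S \<and> b \<in> S} s t \<and>
     agree A {quad a a c c |a c. a \<in> S \<and> c \<in> S} s t}"

text \<open>
  Kernels of families of homomorphisms give the congruences required by Day's argument directly,
  without a construction of generated congruences.
\<close>

lemma Con_hom_kernel:
  assumes "is_algebra \<Sigma> F"
    and hom: "\<And>v f ps. v \<in> V \<Longrightarrow> f \<in> symbs \<Sigma> \<Longrightarrow> length ps = arity \<Sigma> f
      \<Longrightarrow> set ps \<subseteq> carrier F \<Longrightarrow> h v (oper F f ps) = oper A f (map (h v) ps)"
  shows "{(p, q) \<in> carrier F \<times> carrier F. \<forall>v\<in>V. h v p = h v q} \<in> Con \<Sigma> F" (is "?K \<in> _")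
proof -
  have "equiv (carrier F) ?K"
    by (auto simp: equiv_def refl_on_def sym_def trans_def)
  moreover have "(oper F f as, oper F f bs) \<in> ?K"
    if f: "f \<in> symbs \<Sigma>" and l: "length as = arity \<Sigma> f"
      and all: "list_all2 (\<lambda>a b. (a, b) \<in> ?K) as bs" for f as bs
  proof -
    have len: "length bs = length as" using all list_all2_lengthD by force
    have S: "set as \<subseteq> carrier F" "set bs \<subseteq> carrier F"
      using all by (auto simp: list_all2_conv_all_nth in_set_conv_nth)
    have "map (h v) as = map (h v) bs" if "v \<in> V" for v
      using all that by (auto simp: list_all2_conv_all_nth intro!: nth_equalityI)
    then have "h v (oper F f as) = h v (oper F f bs)" if "v \<in> V" for v
      using hom[OF that f] that l len S by simp
    then show ?thesis using assms(1) f l len S by (auto simp: is_algebra_def)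
  qed
  ultimately show ?thesis unfolding Con_def by blast
qed

lemma Con_Int:
  assumes \<theta>: "\<theta> \<in> Con \<Sigma> F" and \<phi>: "\<phi> \<in> Con \<Sigma> F"
  shows "\<theta> \<inter> \<phi> \<in> Con \<Sigma> F"
proof -
  have "equiv (carrier F) (\<theta> \<inter> \<phi>)"
    using \<theta> \<phi> unfolding Con_def equiv_def
    by (auto intro: sym_Int trans_Int simp: refl_on_def)
  moreover have "(oper F f as, oper F f bs) \<in> \<theta> \<inter> \<phi>"
    if f: "f \<in> symbs \<Sigma>" and l: "length as = arity \<Sigma> f"
      and all: "list_all2 (\<lambda>a b. (a, b) \<in> \<theta> \<inter> \<phi>) as bs" for f as bs
  proof -
    have "list_all2 (\<lambda>a b. (a, b) \<in> \<theta>) as bs" "list_all2 (\<lambda>a b. (a, b) \<in> \<phi>) as bs"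
      using list_all2_mono[OF all] by auto
    then show ?thesis using \<theta> \<phi> f l by (auto simp: Con_def)
  qed
  ultimately show ?thesis unfolding Con_def by blast
qed

text \<open>
  In the algebra of term functions with generators \<open>g n\<close>, the pair \<open>(g 0, g 3)\<close> is in \<open>\<chi>\<close>, and
  it is in the join of \<open>\<theta>\<close> and \<open>\<psi>\<close> because \<open>g 0 \<psi> g 1 \<theta> g 2 \<psi> g 3\<close>. Since \<open>\<theta> \<subseteq> \<chi>\<close>, modularity puts
  it into the join of \<open>\<theta>\<close> and \<open>\<psi> \<inter> \<chi>\<close>, that is, into the reflexive transitive closure of their
  union. A path there, read off in terms, is the chain.
\<close>

lemma day_chain:
  fixes A :: "('f, 'a) ualgebra" and E :: "('f trm \<times> 'f trm) set"
  assumes E: "E \<subseteq> terms \<Sigma> \<times> terms \<Sigma>"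
    and room: "terms \<Sigma> \<lesssim> (UNIV :: 'u set)"
    and cm: "congruence_modular TYPE('u) \<Sigma> E"
    and A: "A \<in> variety \<Sigma> E"
  shows "(Var 0, Var 3) \<in> (day_step \<Sigma> A)\<^sup>*"
proof -
  let ?S = "carrier A"
  obtain F :: "('f, 'u) ualgebra" and h :: "(nat \<Rightarrow> 'a) \<Rightarrow> 'u \<Rightarrow> 'a" where F: "F \<in> variety \<Sigma> E"
    and hom: "\<And>v f ps. range v \<subseteq> ?S \<Longrightarrow> f \<in> symbs \<Sigma> \<Longrightarrow> length ps = arity \<Sigma> f
      \<Longrightarrow> set ps \<subseteq> carrier F \<Longrightarrow> h v (oper F f ps) = oper A f (map (h v) ps)"
    and to_term: "\<And>p. p \<in> carrier F
      \<Longrightarrow> \<exists>t\<in>terms \<Sigma>. \<forall>v. range v \<subseteq> ?S \<longrightarrow> h v p = eval A v t"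
    and from_term: "\<And>t. t \<in> terms \<Sigma>
      \<Longrightarrow> \<exists>p\<in>carrier F. \<forall>v. range v \<subseteq> ?S \<longrightarrow> h v p = eval A v t"
    by (rule term_function_algebra[OF A E room, OF that])
  have alg: "is_algebra \<Sigma> F" using F by (simp add: variety_def)
  obtain \<tau> where \<tau>: "\<And>p. p \<in> carrier F \<Longrightarrow> \<tau> p \<in> terms \<Sigma>"
      "\<And>p v. p \<in> carrier F \<Longrightarrow> range v \<subseteq> ?S \<Longrightarrow> h v p = eval A v (\<tau> p)"
    using to_term by metis
  have "\<exists>p\<in>carrier F. \<forall>v. range v \<subseteq> ?S \<longrightarrow> h v p = v n" for n
    using from_term[OF terms.Var[of n]] by simp
  then obtain g where g: "\<And>n. g n \<in> carrier F"
      "\<And>n v. range v \<subseteq> ?S \<Longrightarrow> h v (g n) = v n" by metis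
  define V\<theta> where "V\<theta> = {quad a b b c |a b c. a \<in> ?S \<and> b \<in> ?S \<and> c \<in> ?S}"
  define V\<chi> where "V\<chi> = {quad a b b a |a b. a \<in> ?S \<and> b \<in> ?S}"
  define V\<psi> where "V\<psi> = {quad a a c c |a c. a \<in> ?S \<and> c \<in> ?S}"
  note V_defs = V\<theta>_def V\<chi>_def V\<psi>_def
  have V: "range v \<subseteq> ?S" if "v \<in> V\<theta> \<union> V\<chi> \<union> V\<psi>" for v
    using that by (auto simp: V_defs quad_def)
  define ker where "ker V = {(p, q) \<in> carrier F \<times> carrier F. \<forall>v\<in>V. h v p = h v q}" for V
  have ker_Con: "ker U \<in> Con \<Sigma> F" if "U \<subseteq> V\<theta> \<union> V\<chi> \<union> V\<psi>" for U
    unfolding ker_def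
  proof (rule Con_hom_kernel[OF alg])
    fix v f ps assume "v \<in> U" and fps: "f \<in> symbs \<Sigma>" "length ps = arity \<Sigma> f" "set ps \<subseteq> carrier F"
    then have "range v \<subseteq> ?S" using that V by blast
    then show "h v (oper F f ps) = oper A f (map (h v) ps)" using hom fps by blast
  qed
  have Con: "ker V\<theta> \<in> Con \<Sigma> F" "ker V\<psi> \<in> Con \<Sigma> F" "ker V\<chi> \<in> Con \<Sigma> F"
    by (auto intro: ker_Con)
  have int: "ker V\<psi> \<inter> ker V\<chi> \<in> Con \<Sigma> F" by (intro Con_Int Con)
  have "V\<chi> \<subseteq> V\<theta>" by (auto simp: V_defs)
  then have le: "ker V\<theta> \<subseteq> ker V\<chi>" by (auto simp: ker_def)
  let ?r = "ker V\<theta> \<union> (ker V\<psi> \<inter> ker V\<chi>)"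
  let ?W = "?r\<^sup>* \<inter> carrier F \<times> carrier F"
  have W: "?W \<in> Con \<Sigma> F" by (rule Con_rtrancl_Un[OF alg Con(1) int])
  have subW: "ker V\<theta> \<subseteq> ?W" "ker V\<psi> \<inter> ker V\<chi> \<subseteq> ?W"
    by (auto simp: ker_def)
  obtain J where J: "J \<in> Con \<Sigma> F" "ker V\<theta> \<subseteq> J" "ker V\<psi> \<subseteq> J" "J \<inter> ker V\<chi> \<subseteq> ?W"
    using modular_lattice_by_inclusionD[OF _ Con le Con_Int W subW] cm F
    unfolding congruence_modular_def by blast
  have "(g 0, g 1) \<in> ker V\<psi>" "(g 1, g 2) \<in> ker V\<theta>" "(g 2, g 3) \<in> ker V\<psi>" "(g 0, g 3) \<in> ker V\<chi>"
    using g V by (auto simp: ker_def V_defs) (auto simp: quad_def)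
  moreover have "trans J" using J(1) by (auto simp: Con_def equiv_def)
  ultimately have "(g 0, g 3) \<in> J \<inter> ker V\<chi>"
    using J(2,3) by (meson IntI subsetD transD)
  then have "(g 0, g 3) \<in> ?r\<^sup>*" using J(4) by blast
  then have "(\<tau> (g 0), \<tau> (g 3)) \<in> (day_step \<Sigma> A)\<^sup>*"
  proof induction
    case (step p q)
    then have pq: "p \<in> carrier F" "q \<in> carrier F" by (auto simp: ker_def)
    have "(\<tau> p, \<tau> q) \<in> day_step \<Sigma> A"
      using step(2) pq \<tau> V unfolding day_step_def Let_def V_defs[symmetric]
      by (auto simp: ker_def agree_def)
    with step.IH show ?case by (rule rtrancl_into_rtrancl)
  qed simp
  \<comment> \<open>The chosen term for \<open>g n\<close> may differ from \<open>Var n\<close>, but it has the same values.\<close>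
  moreover have "eval A v (\<tau> (g n)) = v n" if "range v \<subseteq> ?S" for v n
    using \<tau>(2)[OF g(1) that] g(2)[OF that] by simp
  then have "(Var n, \<tau> (g n)) \<in> day_step \<Sigma> A" "(\<tau> (g n), Var n) \<in> day_step \<Sigma> A" for n
    using V \<tau>(1)[OF g(1)] unfolding day_step_def Let_def V_defs[symmetric]
    by (auto simp: agree_def intro: terms.Var)
  ultimately show ?thesis
    by (meson converse_rtrancl_into_rtrancl rtrancl.rtrancl_into_rtrancl)
qed


section \<open>Compatible superequivalences\<close>

lemma SupEqv_iff:
  "I \<in> SupEqv \<Sigma> A \<longleftrightarrow> I \<in> Idl_Rel (carrier A) \<and> Id_on (carrier A) \<in> I \<and>
     (\<forall>R\<in>I. R\<inverse> \<in> I) \<and> (\<forall>R\<in>I. \<forall>Q\<in>I. R O Q \<in> I) \<and> compatible \<Sigma> A I"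
proof -
  have "I = ideal_op I \<longleftrightarrow> (\<forall>R\<in>I. R\<inverse> \<in> I)"
  proof
    assume "I = ideal_op I"
    then show "\<forall>R\<in>I. R\<inverse> \<in> I" unfolding ideal_op_def by blast
  next
    assume conv: "\<forall>R\<in>I. R\<inverse> \<in> I"
    have "R \<in> ideal_op I" if "R \<in> I" for R
      unfolding ideal_op_def using conv that
      by (intro CollectI exI[of _ "R\<inverse>"]) simp
    then show "I = ideal_op I" using conv unfolding ideal_op_def by blast
  qed
  moreover have "ideal_comp (carrier A) I I \<subseteq> I \<longleftrightarrow> (\<forall>R\<in>I. \<forall>Q\<in>I. R O Q \<in> I)"
    if "I \<in> Idl_Rel (carrier A)"
  proof -
    have "Ig (carrier A) X \<subseteq> I \<longleftrightarrow> X \<subseteq> I" for X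
      using that unfolding Ig_def by blast
    from this[of "{R O Q |R Q. R \<in> I \<and> Q \<in> I}"] show ?thesis
      unfolding ideal_comp_def by (auto simp del: subset_iff)
  qed
  ultimately show ?thesis
    unfolding SupEqv_def superequivalence_def by blast
qed

text \<open>
  Compatible superequivalences without the closure under composition, in analogy to tolerance
  relations. The stages of a join have only these properties.
\<close>

definition compatible_tolerance :: "'f signature \<Rightarrow> ('f, 'a) ualgebra \<Rightarrow> 'a rel set \<Rightarrow> bool" where
  "compatible_tolerance \<Sigma> A I \<longleftrightarrow> I \<in> Idl_Rel (carrier A) \<and> Id_on (carrier A) \<in> I \<and>
     (\<forall>R\<in>I. R\<inverse> \<in> I) \<and> compatible \<Sigma> A I"

lemma SupEqv_tolerance: "I \<in> SupEqv \<Sigma> A \<Longrightarrow> compatible_tolerance \<Sigma> A I"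
  by (simp add: SupEqv_iff compatible_tolerance_def)

lemma SupEqv_relcomp: "I \<in> SupEqv \<Sigma> A \<Longrightarrow> R \<in> I \<Longrightarrow> Q \<in> I \<Longrightarrow> R O Q \<in> I"
  by (simp add: SupEqv_iff)

lemma tolerance_rules:
  assumes "compatible_tolerance \<Sigma> A I"
  shows tolerance_Id: "Id_on (carrier A) \<in> I"
    and tolerance_mono: "\<And>R Q. R \<in> I \<Longrightarrow> Q \<subseteq> R \<Longrightarrow> Q \<in> I"
    and tolerance_Un: "\<And>R Q. R \<in> I \<Longrightarrow> Q \<in> I \<Longrightarrow> R \<union> Q \<in> I"
    and tolerance_converse: "\<And>R. R \<in> I \<Longrightarrow> R\<inverse> \<in> I"
    and tolerance_sub: "\<And>R. R \<in> I \<Longrightarrow> R \<subseteq> carrier A \<times> carrier A"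
    and tolerance_oper: "\<And>f Rs. f \<in> symbs \<Sigma> \<Longrightarrow> length Rs = arity \<Sigma> f \<Longrightarrow> set Rs \<subseteq> I
      \<Longrightarrow> rel_oper A f Rs \<in> I"
  using assms unfolding compatible_tolerance_def Idl_Rel_def compatible_def by auto

lemma SupEqv_Int:
  assumes "I \<in> SupEqv \<Sigma> A" "J \<in> SupEqv \<Sigma> A"
  shows "I \<inter> J \<in> SupEqv \<Sigma> A"
  using assms unfolding SupEqv_iff Idl_Rel_def compatible_def by auto

lemma rel_operI:
  assumes "length as = length Rs" "length bs = length Rs"
    and "\<And>i. i < length Rs \<Longrightarrow> (as ! i, bs ! i) \<in> Rs ! i"
  shows "(oper A f as, oper A f bs) \<in> rel_oper A f Rs"
  using assms unfolding rel_oper_def by blast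

definition term_rel :: "('f, 'a) ualgebra \<Rightarrow> 'f trm \<Rightarrow> (nat \<Rightarrow> 'a rel) \<Rightarrow> 'a rel" where
  "term_rel A t Rs = {(eval A v t, eval A w t) |v w. \<forall>n. (v n, w n) \<in> Rs n}"

text \<open>
  Compatibility extends from basic operations to terms: the relation of a composite term lies
  below the basic operation applied to the relations of its immediate subterms.
\<close>

lemma term_rel_in_tolerance:
  assumes I: "compatible_tolerance \<Sigma> A I" and t: "t \<in> terms \<Sigma>" and Rs: "\<And>n. Rs n \<in> I"
  shows "term_rel A t Rs \<in> I"
  using t
proof induction
  case (Var i)
  have "term_rel A (Var i) Rs \<subseteq> Rs i" by (auto simp: term_rel_def)
  then show ?case using tolerance_mono[OF I Rs] by blast
next
  case (App f ts)
  let ?Rs = "map (\<lambda>t. term_rel A t Rs) ts"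
  have "term_rel A (App f ts) Rs \<subseteq> rel_oper A f ?Rs"
  proof
    fix x assume "x \<in> term_rel A (App f ts) Rs"
    then obtain v w where vw: "\<forall>n. (v n, w n) \<in> Rs n"
      "x = (oper A f (map (eval A v) ts), oper A f (map (eval A w) ts))"
      by (auto simp: term_rel_def)
    show "x \<in> rel_oper A f ?Rs"
      unfolding vw(2) by (rule rel_operI) (use vw(1) in \<open>auto simp: term_rel_def\<close>)
  qed
  moreover have "rel_oper A f ?Rs \<in> I"
    using App by (intro tolerance_oper[OF I]) auto
  ultimately show ?case using tolerance_mono[OF I] by blast
qed


section \<open>Joins of superequivalences\<close>

text \<open>
  Placing a member of \<open>I\<close> between two members of \<open>\<Phi>\<close> mirrors the induction step
  \<open>\<phi> \<circ> \<theta> \<circ> \<phi>\<close> of Day's proof. Iteration exhausts the join, since one more round already composes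
  any two members of \<open>\<Phi>\<close> (with the identity in the middle).
\<close>

definition sandwich :: "'a rel set \<Rightarrow> 'a rel set \<Rightarrow> 'a rel set" where
  "sandwich I \<Phi> = {T. \<exists>P\<in>\<Phi>. \<exists>R\<in>I. \<exists>Q\<in>\<Phi>. T \<subseteq> P O R O Q}"

lemma sandwichI: "P \<in> \<Phi> \<Longrightarrow> R \<in> I \<Longrightarrow> Q \<in> \<Phi> \<Longrightarrow> T \<subseteq> P O R O Q \<Longrightarrow> T \<in> sandwich I \<Phi>"
  unfolding sandwich_def by blast

lemma rel_oper_relcomp3:
  assumes "length Ps = n" "length Rs = n" "length Qs = n" "length Ts = n"
    and T: "\<And>i. i < n \<Longrightarrow> Ts ! i \<subseteq> Ps ! i O Rs ! i O Qs ! i"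
  shows "rel_oper A f Ts \<subseteq> rel_oper A f Ps O rel_oper A f Rs O rel_oper A f Qs"
proof
  fix x assume "x \<in> rel_oper A f Ts"
  then obtain as ds where x: "x = (oper A f as, oper A f ds)" and l: "length as = n" "length ds = n"
    and T': "\<forall>i<n. (as ! i, ds ! i) \<in> Ts ! i"
    unfolding rel_oper_def using assms(4) by auto
  have "\<forall>i<n. \<exists>b c. (as ! i, b) \<in> Ps ! i \<and> (b, c) \<in> Rs ! i \<and> (c, ds ! i) \<in> Qs ! i"
    using T' T by blast
  then obtain b c where bc: "\<And>i. i < n \<Longrightarrow> (as ! i, b i) \<in> Ps ! i"
    "\<And>i. i < n \<Longrightarrow> (b i, c i) \<in> Rs ! i" "\<And>i. i < n \<Longrightarrow> (c i, ds ! i) \<in> Qs ! i"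
    by metis
  have "(oper A f as, oper A f (map b [0..<n])) \<in> rel_oper A f Ps"
    "(oper A f (map b [0..<n]), oper A f (map c [0..<n])) \<in> rel_oper A f Rs"
    "(oper A f (map c [0..<n]), oper A f ds) \<in> rel_oper A f Qs"
    using assms(1-3) l bc by (auto intro!: rel_operI)
  then show "x \<in> rel_oper A f Ps O rel_oper A f Rs O rel_oper A f Qs"
    unfolding x by blast
qed

lemma sandwich_supset:
  assumes I: "compatible_tolerance \<Sigma> A I" and \<Phi>: "compatible_tolerance \<Sigma> A \<Phi>"
  shows "I \<union> \<Phi> \<subseteq> sandwich I \<Phi>"
proof
  fix R assume R: "R \<in> I \<union> \<Phi>"
  then have sub: "R \<subseteq> carrier A \<times> carrier A"
    using tolerance_sub[OF I] tolerance_sub[OF \<Phi>] by auto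
  let ?\<Delta> = "Id_on (carrier A)"
  show "R \<in> sandwich I \<Phi>"
  proof (cases "R \<in> I")
    case True
    then show ?thesis using sub tolerance_Id[OF \<Phi>]
      by (intro sandwichI[of ?\<Delta> _ R _ ?\<Delta>]) auto
  next
    case False
    with R have "R \<in> \<Phi>" by blast
    then show ?thesis using sub tolerance_Id[OF \<Phi>] tolerance_Id[OF I]
      by (intro sandwichI[of R _ ?\<Delta> _ ?\<Delta>]) auto
  qed
qed

lemma sandwich_tolerance:
  assumes I: "compatible_tolerance \<Sigma> A I" and \<Phi>: "compatible_tolerance \<Sigma> A \<Phi>"
  shows "compatible_tolerance \<Sigma> A (sandwich I \<Phi>)"
proof -
  let ?M = "sandwich I \<Phi>"
  have Id: "Id_on (carrier A) \<in> ?M"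
    using sandwich_supset[OF I \<Phi>] tolerance_Id[OF I] by blast
  have sub: "T \<subseteq> carrier A \<times> carrier A" if "T \<in> ?M" for T
    using that tolerance_sub[OF \<Phi>] unfolding sandwich_def by blast
  have mono: "U \<in> ?M" if "T \<in> ?M" "U \<subseteq> T" for T U
    using that unfolding sandwich_def by blast
  have Un: "T \<union> T' \<in> ?M" if T: "T \<in> ?M" and T': "T' \<in> ?M" for T T'
  proof -
    from T obtain P R Q where 1: "P \<in> \<Phi>" "R \<in> I" "Q \<in> \<Phi>" "T \<subseteq> P O R O Q"
      unfolding sandwich_def by blast
    from T' obtain P' R' Q' where 2: "P' \<in> \<Phi>" "R' \<in> I" "Q' \<in> \<Phi>" "T' \<subseteq> P' O R' O Q'"
      unfolding sandwich_def by blast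
    have "T \<union> T' \<subseteq> (P \<union> P') O (R \<union> R') O (Q \<union> Q')" using 1(4) 2(4) by blast
    then show ?thesis
      using 1 2 by (intro sandwichI[OF tolerance_Un[OF \<Phi>] tolerance_Un[OF I] tolerance_Un[OF \<Phi>]])
  qed
  have conv: "T\<inverse> \<in> ?M" if T: "T \<in> ?M" for T
  proof -
    from T obtain P R Q where 1: "P \<in> \<Phi>" "R \<in> I" "Q \<in> \<Phi>" "T \<subseteq> P O R O Q"
      unfolding sandwich_def by blast
    have "T\<inverse> \<subseteq> Q\<inverse> O R\<inverse> O P\<inverse>" using 1(4) by blast
    then show ?thesis
      by (rule sandwichI[rotated 3]) (use 1 tolerance_converse[OF \<Phi>] tolerance_converse[OF I] in auto)
  qed
  have "rel_oper A f Ts \<in> ?M"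
    if f: "f \<in> symbs \<Sigma>" and l: "length Ts = arity \<Sigma> f" and Ts: "set Ts \<subseteq> ?M" for f Ts
  proof -
    have "\<forall>T\<in>set Ts. \<exists>P R Q. P \<in> \<Phi> \<and> R \<in> I \<and> Q \<in> \<Phi> \<and> T \<subseteq> P O R O Q"
      using Ts unfolding sandwich_def by blast
    then obtain P R Q where PRQ: "\<And>T. T \<in> set Ts \<Longrightarrow> P T \<in> \<Phi>" "\<And>T. T \<in> set Ts \<Longrightarrow> R T \<in> I"
        "\<And>T. T \<in> set Ts \<Longrightarrow> Q T \<in> \<Phi>" "\<And>T. T \<in> set Ts \<Longrightarrow> T \<subseteq> P T O R T O Q T"
      by metis
    have "rel_oper A f Ts \<subseteq>
        rel_oper A f (map P Ts) O rel_oper A f (map R Ts) O rel_oper A f (map Q Ts)"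
      using PRQ(4) by (intro rel_oper_relcomp3[where n = "length Ts"]) simp_all
    moreover have "rel_oper A f (map P Ts) \<in> \<Phi>" "rel_oper A f (map R Ts) \<in> I"
        "rel_oper A f (map Q Ts) \<in> \<Phi>"
      using PRQ f l by (auto intro!: tolerance_oper[OF I] tolerance_oper[OF \<Phi>])
    ultimately show ?thesis by (auto intro: sandwichI)
  qed
  then show ?thesis
    unfolding compatible_tolerance_def Idl_Rel_def compatible_def
    using Id sub mono Un conv by auto
qed

definition join_stage :: "'a rel set \<Rightarrow> 'a rel set \<Rightarrow> nat \<Rightarrow> 'a rel set" where
  "join_stage I J k = (sandwich I ^^ k) J"

definition sup_join :: "'a rel set \<Rightarrow> 'a rel set \<Rightarrow> 'a rel set" where
  "sup_join I J = (\<Union>k. join_stage I J k)"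

lemma join_stage_simps [simp]:
  "join_stage I J 0 = J"
  "join_stage I J (Suc k) = sandwich I (join_stage I J k)"
  by (simp_all add: join_stage_def)

context
  fixes \<Sigma> :: "'f signature" and A :: "('f, 'a) ualgebra" and I J :: "'a rel set"
  assumes I: "I \<in> SupEqv \<Sigma> A" and J: "J \<in> SupEqv \<Sigma> A"
begin

lemma join_stage_tolerance: "compatible_tolerance \<Sigma> A (join_stage I J k)"
  by (induction k) (simp_all add: SupEqv_tolerance I J sandwich_tolerance)

lemma join_stage_mono: "k \<le> l \<Longrightarrow> join_stage I J k \<subseteq> join_stage I J l"
proof (rule lift_Suc_mono_le[of "join_stage I J"])
  fix m show "join_stage I J m \<subseteq> join_stage I J (Suc m)"
    using sandwich_supset[OF SupEqv_tolerance[OF I] join_stage_tolerance[of m]] by simp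
qed

lemma sup_join_upper: "I \<union> J \<subseteq> sup_join I J"
proof -
  have "I \<union> J \<subseteq> join_stage I J 1"
    using sandwich_supset[OF SupEqv_tolerance[OF I] SupEqv_tolerance[OF J]] by simp
  then show ?thesis unfolding sup_join_def by blast
qed

lemma sup_join_SupEqv: "sup_join I J \<in> SupEqv \<Sigma> A"
proof -
  let ?U = "sup_join I J"
  \<comment> \<open>The stages increase, so finitely many members lie in a common one.\<close>
  have stage: "\<exists>k. set Rs \<subseteq> join_stage I J k" if "set Rs \<subseteq> ?U" for Rs
    using that
  proof (induction Rs)
    case (Cons R Rs)
    then obtain k l where "set Rs \<subseteq> join_stage I J k" "R \<in> join_stage I J l"
      by (auto simp: sup_join_def)
    then have "set (R # Rs) \<subseteq> join_stage I J (max k l)"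
      using join_stage_mono[of k "max k l"] join_stage_mono[of l "max k l"] by auto
    then show ?case by blast
  qed simp
  have pair: "\<exists>k. R \<in> join_stage I J k \<and> Q \<in> join_stage I J k" if "R \<in> ?U" "Q \<in> ?U" for R Q
    using stage[of "[R, Q]"] that by simp
  have incl: "R \<in> ?U" if "R \<in> join_stage I J k" for R k
    using that unfolding sup_join_def by blast
  note tol = join_stage_tolerance
  have Id: "Id_on (carrier A) \<in> ?U" using incl[OF tolerance_Id[OF tol]] .
  have sub: "R \<subseteq> carrier A \<times> carrier A" if "R \<in> ?U" for R
    using that tolerance_sub[OF tol] unfolding sup_join_def by blast
  have mono: "Q \<in> ?U" if "R \<in> ?U" "Q \<subseteq> R" for R Q
    using that tolerance_mono[OF tol] unfolding sup_join_def by blast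
  have Un: "R \<union> Q \<in> ?U" if "R \<in> ?U" "Q \<in> ?U" for R Q
    using pair[OF that] tolerance_Un[OF tol] incl by blast
  have conv: "R\<inverse> \<in> ?U" if "R \<in> ?U" for R
    using that tolerance_converse[OF tol] unfolding sup_join_def by blast
  have comp: "R O Q \<in> ?U" if RQ: "R \<in> ?U" "Q \<in> ?U" for R Q
  proof -
    obtain k where k: "R \<in> join_stage I J k" "Q \<in> join_stage I J k" using pair[OF RQ] by blast
    have "R O Q \<subseteq> R O Id_on (carrier A) O Q" using sub[OF RQ(1)] by auto
    then have "R O Q \<in> join_stage I J (Suc k)"
      using k tolerance_Id[OF SupEqv_tolerance[OF I]] by (simp add: sandwichI)
    then show ?thesis by (rule incl)
  qed
  have "compatible \<Sigma> A ?U"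
    unfolding compatible_def using stage tolerance_oper[OF tol] incl by blast
  then show ?thesis
    unfolding SupEqv_iff Idl_Rel_def using Id sub mono Un conv comp by auto
qed

lemma sup_join_least:
  assumes Z: "Z \<in> SupEqv \<Sigma> A" and le: "I \<union> J \<subseteq> Z"
  shows "sup_join I J \<subseteq> Z"
proof -
  have "join_stage I J k \<subseteq> Z" for k
  proof (induction k)
    case (Suc k)
    show ?case
    proof
      fix T assume "T \<in> join_stage I J (Suc k)"
      then obtain P R Q where "P \<in> Z" "R \<in> Z" "Q \<in> Z" "T \<subseteq> P O R O Q"
        using Suc le unfolding join_stage_simps sandwich_def by blast
      then show "T \<in> Z"
        using tolerance_mono[OF SupEqv_tolerance[OF Z]] SupEqv_relcomp[OF Z] by meson
    qed
  qed (use le in simp)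
  then show ?thesis unfolding sup_join_def by blast
qed

end


section \<open>The modular law\<close>

lemma term_rel_quadI:
  assumes "(a, a') \<in> R0" "(b, b') \<in> R1" "(c, c') \<in> R2" "(d, d') \<in> R3"
  shows "(eval A (quad a b c d) t, eval A (quad a' b' c' d') t) \<in> term_rel A t (quad R0 R1 R2 R3)"
proof -
  have "\<forall>n. (quad a b c d n, quad a' b' c' d' n) \<in> quad R0 R1 R2 R3 n"
    using assms by (simp add: quad_def)
  then show ?thesis unfolding term_rel_def by blast
qed

lemma term_rel_quad_in_tolerance:
  assumes "compatible_tolerance \<Sigma> A I" "t \<in> terms \<Sigma>" "R0 \<in> I" "R1 \<in> I" "R2 \<in> I" "R3 \<in> I"
  shows "term_rel A t (quad R0 R1 R2 R3) \<in> I"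
  using assms by (intro term_rel_in_tolerance) (auto simp: quad_def)

text \<open>
  The step \<open>\<Phi> \<mapsto> sandwich I \<Phi>\<close> does not lead out of \<open>W\<close> inside \<open>K\<close>. This is the relational form
  of Day's key lemma: if \<open>(b, d)\<close> is in a congruence \<open>W\<close> and every term \<open>t\<close> of the chain gives
  \<open>W\<close>-related values \<open>t[a, a, c, c]\<close> and \<open>t[a, b, d, c]\<close>, then \<open>(a, c)\<close> is in \<open>W\<close>.
\<close>

lemma sandwich_shift:
  assumes day: "(Var 0, Var 3) \<in> (day_step \<Sigma> A)\<^sup>*"
    and I: "I \<in> SupEqv \<Sigma> A" and K: "K \<in> SupEqv \<Sigma> A" and W: "W \<in> SupEqv \<Sigma> A"
    and \<Phi>: "compatible_tolerance \<Sigma> A \<Phi>"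
    and IK: "I \<subseteq> K" and IW: "I \<subseteq> W" and \<Phi>W: "\<Phi> \<inter> K \<subseteq> W"
  shows "sandwich I \<Phi> \<inter> K \<subseteq> W"
proof
  fix T assume T: "T \<in> sandwich I \<Phi> \<inter> K"
  then obtain P R Q where P: "P \<in> \<Phi>" and R: "R \<in> I" and Q: "Q \<in> \<Phi>" and TPRQ: "T \<subseteq> P O R O Q"
    unfolding sandwich_def by blast
  have TK: "T \<in> K" using T by blast
  let ?S = "carrier A" and ?\<Delta> = "Id_on (carrier A)"
  note tol = SupEqv_tolerance
  have RK: "R \<in> K" and RW: "R \<in> W" using R IK IW by auto
  define D where "D = {(a, b, d, c). (a, b) \<in> P \<and> (b, d) \<in> R \<and> (d, c) \<in> Q \<and> (a, c) \<in> T}"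
  have D_S: "a \<in> ?S" "b \<in> ?S" "d \<in> ?S" "c \<in> ?S" if "(a, b, d, c) \<in> D" for a b c d
    using that tolerance_sub[OF tol[OF I] R] tolerance_sub[OF tol[OF K] TK]
    unfolding D_def by auto
  \<comment> \<open>\<open>X t\<close> is the part of the walk from \<open>a\<close> up to \<open>t\<close>: it starts inside the identity and ends as \<open>T\<close>.\<close>
  define X where "X t = {(a, eval A (quad a b d c) t) |a b c d. (a, b, d, c) \<in> D}" for t
  define U where "U t = {(eval A (quad a a c c) t, eval A (quad a b d c) t) |a b c d.
    (a, b, d, c) \<in> D}" for t
  have U_W: "U t \<in> W"
    if t: "t \<in> terms \<Sigma>" and idem: "\<And>a b. a \<in> ?S \<Longrightarrow> b \<in> ?S \<Longrightarrow> eval A (quad a b b a) t = a" for t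
  proof -
    have "U t \<subseteq> term_rel A t (quad ?\<Delta> P (Q\<inverse>) ?\<Delta>)"
      using D_S unfolding U_def by (auto intro!: term_rel_quadI simp: D_def)
    moreover have "term_rel A t (quad ?\<Delta> P (Q\<inverse>) ?\<Delta>) \<in> \<Phi>"
      using P Q tolerance_Id[OF \<Phi>] tolerance_converse[OF \<Phi>]
      by (intro term_rel_quad_in_tolerance[OF \<Phi> t]) auto
    ultimately have 1: "U t \<in> \<Phi>" using tolerance_mono[OF \<Phi>] by blast
    \<comment> \<open>through \<open>t[a, a, a, a] = a = t[a, b, b, a]\<close>\<close>
    let ?L = "term_rel A t (quad ?\<Delta> ?\<Delta> (T\<inverse>) (T\<inverse>))" and ?M = "term_rel A t (quad ?\<Delta> ?\<Delta> R T)"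
    have "U t \<subseteq> ?L O ?M"
    proof
      fix x assume "x \<in> U t"
      then obtain a b c d where D: "(a, b, d, c) \<in> D"
        and x: "x = (eval A (quad a a c c) t, eval A (quad a b d c) t)"
        unfolding U_def by blast
      note S = D_S[OF D]
      have "(eval A (quad a a c c) t, eval A (quad a a a a) t) \<in> ?L"
        using S D by (intro term_rel_quadI) (auto simp: D_def)
      moreover have "(eval A (quad a b b a) t, eval A (quad a b d c) t) \<in> ?M"
        using S D by (intro term_rel_quadI) (auto simp: D_def)
      ultimately show "x \<in> ?L O ?M" unfolding x using idem S by auto
    qed
    moreover have "?L \<in> K" "?M \<in> K"
      using TK RK tolerance_Id[OF tol[OF K]] tolerance_converse[OF tol[OF K]]
      by (auto intro!: term_rel_quad_in_tolerance[OF tol[OF K] t])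
    ultimately have "U t \<in> K"
      using tolerance_mono[OF tol[OF K]] SupEqv_relcomp[OF K] by blast
    with 1 \<Phi>W show ?thesis by blast
  qed
  have "t \<in> terms \<Sigma> \<and> (\<forall>a\<in>?S. \<forall>b\<in>?S. eval A (quad a b b a) t = a) \<and> X t \<in> W"
    if "(Var 0, t) \<in> (day_step \<Sigma> A)\<^sup>*" for t
    using that
  proof induction
    case base
    have "X (Var 0) \<subseteq> ?\<Delta>" using D_S by (auto simp: X_def quad_def)
    then have "X (Var 0) \<in> W" using tolerance_mono[OF tol[OF W] tolerance_Id[OF tol[OF W]]] by blast
    then show ?case by (simp add: terms.Var quad_def)
  next
    case (step s t)
    then have s: "s \<in> terms \<Sigma>" and t: "t \<in> terms \<Sigma>"
      and s_idem: "\<And>a b. a \<in> ?S \<Longrightarrow> b \<in> ?S \<Longrightarrow> eval A (quad a b b a) s = a" and Xs: "X s \<in> W"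
      by (auto simp: day_step_def)
    from step(2) consider
        (\<theta>) "\<And>a b c. a \<in> ?S \<Longrightarrow> b \<in> ?S \<Longrightarrow> c \<in> ?S
          \<Longrightarrow> eval A (quad a b b c) s = eval A (quad a b b c) t"
      | (\<chi>\<psi>) "\<And>a b. a \<in> ?S \<Longrightarrow> b \<in> ?S \<Longrightarrow> eval A (quad a b b a) s = eval A (quad a b b a) t"
          "\<And>a c. a \<in> ?S \<Longrightarrow> c \<in> ?S \<Longrightarrow> eval A (quad a a c c) s = eval A (quad a a c c) t"
      unfolding day_step_def Let_def agree_def by blast
    then show ?case
    proof cases
      case \<theta>
      \<comment> \<open>through \<open>s[a, b, b, c] = t[a, b, b, c]\<close>\<close>
      let ?L = "term_rel A s (quad ?\<Delta> ?\<Delta> (R\<inverse>) ?\<Delta>)" and ?M = "term_rel A t (quad ?\<Delta> ?\<Delta> R ?\<Delta>)"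
      have "X t \<subseteq> X s O ?L O ?M"
      proof
        fix x assume "x \<in> X t"
        then obtain a b c d where D: "(a, b, d, c) \<in> D" and x: "x = (a, eval A (quad a b d c) t)"
          unfolding X_def by blast
        note S = D_S[OF D]
        have "(a, eval A (quad a b d c) s) \<in> X s" using D unfolding X_def by blast
        moreover have "(eval A (quad a b d c) s, eval A (quad a b b c) s) \<in> ?L"
          using S D by (intro term_rel_quadI) (auto simp: D_def)
        moreover have "(eval A (quad a b b c) t, eval A (quad a b d c) t) \<in> ?M"
          using S D by (intro term_rel_quadI) (auto simp: D_def)
        ultimately show "x \<in> X s O ?L O ?M" unfolding x using \<theta> S by auto
      qed
      moreover have "?L \<in> W" "?M \<in> W"
        using RW s t tolerance_Id[OF tol[OF W]] tolerance_converse[OF tol[OF W]]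
        by (auto intro!: term_rel_quad_in_tolerance[OF tol[OF W]])
      ultimately have "X t \<in> W"
        using Xs tolerance_mono[OF tol[OF W]] SupEqv_relcomp[OF W] by meson
      with t s_idem \<theta> show ?thesis by force
    next
      case \<chi>\<psi>
      then have t_idem: "eval A (quad a b b a) t = a" if "a \<in> ?S" "b \<in> ?S" for a b
        using s_idem that by force
      \<comment> \<open>through \<open>s[a, a, c, c] = t[a, a, c, c]\<close>\<close>
      have "X t \<subseteq> X s O (U s)\<inverse> O U t"
      proof
        fix x assume "x \<in> X t"
        then obtain a b c d where D: "(a, b, d, c) \<in> D" and x: "x = (a, eval A (quad a b d c) t)"
          unfolding X_def by blast
        note S = D_S[OF D]
        have "(a, eval A (quad a b d c) s) \<in> X s" using D unfolding X_def by blast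
        moreover have "(eval A (quad a a c c) s, eval A (quad a b d c) s) \<in> U s"
          "(eval A (quad a a c c) t, eval A (quad a b d c) t) \<in> U t"
          using D unfolding U_def by blast+
        ultimately show "x \<in> X s O (U s)\<inverse> O U t" unfolding x using \<chi>\<psi>(2) S by auto
      qed
      moreover have "U s \<in> W" "U t \<in> W" using U_W s t s_idem t_idem by auto
      ultimately have "X t \<in> W"
        using Xs tolerance_mono[OF tol[OF W]] tolerance_converse[OF tol[OF W]] SupEqv_relcomp[OF W]
        by meson
      with t t_idem show ?thesis by blast
    qed
  qed
  from this[OF day] have "X (Var 3) \<in> W" by blast
  moreover have "T \<subseteq> X (Var 3)"
    using TPRQ by (force simp: X_def D_def quad_def)
  ultimately show "T \<in> W" using tolerance_mono[OF tol[OF W]] by blast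
qed

theorem theorem2p24:
  fixes \<Sigma> :: "'f signature"
    and E :: "('f trm \<times> 'f trm) set"
    and A :: "('f, 'a) ualgebra"
  assumes "E \<subseteq> terms \<Sigma> \<times> terms \<Sigma>"
    and "terms \<Sigma> \<lesssim> (UNIV :: 'u set)"
    and "congruence_modular TYPE('u) \<Sigma> E"
    and "A \<in> variety \<Sigma> E"
  shows "modular_lattice (by_inclusion (SupEqv \<Sigma> A))"
proof (rule modular_lattice_by_inclusionI[where j = sup_join])
  fix I J K
  assume I: "I \<in> SupEqv \<Sigma> A" and J: "J \<in> SupEqv \<Sigma> A" and K: "K \<in> SupEqv \<Sigma> A" and IK: "I \<subseteq> K"
  note day = day_chain[OF assms]
  have JK: "J \<inter> K \<in> SupEqv \<Sigma> A" by (rule SupEqv_Int[OF J K])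
  let ?W = "sup_join I (J \<inter> K)"
  have up: "I \<union> J \<inter> K \<subseteq> ?W" by (rule sup_join_upper[OF I JK])
  have "join_stage I J k \<inter> K \<subseteq> ?W" for k
  proof (induction k)
    case (Suc k)
    show ?case unfolding join_stage_simps
      using up Suc
      by (intro sandwich_shift[OF day I K sup_join_SupEqv[OF I JK] join_stage_tolerance[OF I J] IK])
        auto
  qed (use up in auto)
  then show "sup_join I J \<inter> K \<subseteq> ?W" unfolding sup_join_def[of I J] by blast
qed (rule SupEqv_Int sup_join_SupEqv sup_join_upper sup_join_least; assumption)+

end
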